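(* There exist infinitely many infinite sets $\Lambda\subset\mathbb{R}$ such that $\{e_\ell:\ell\in\Lambda\}$ is a mutually orthogonal set of functions with respect to the measure $\nu_{3/4}$.
   Context: Let $\tau_+(x)=\frac34 x+1$ and $\tau_-(x)=\frac34 x-1$ on $\mathbb{R}$. The measure $\nu_{3/4}$ is the unique Borel probability measure on $\mathbb{R}$ satisfying $\nu_{3/4}=\frac12(\nu_{3/4}\circ\tau_+^{-1}+\nu_{3/4}\circ\tau_-^{-1})$. For $\ell\in\mathbb{R}$, $e_\ell(x)=e^{2\pi i\ell x}$. The set $\{e_\ell:\ell\in\Lambda\}$ is mutually orthogonal if $\int e_\ell\,\overline{e_{\ell'}}\,d\nu_{3/4}=0$ for all distinct $\ell,\ell'\in\Lambda$. *)

theory Defs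
  imports "HOL-Probability.Probability"
begin

definition tau_plus :: "real \<Rightarrow> real" where
  "tau_plus x = 3 / 4 * x + 1"

definition tau_minus :: "real \<Rightarrow> real" where
  "tau_minus x = 3 / 4 * x - 1"

definition self_similar_34 :: "real measure \<Rightarrow> bool" where
  "self_similar_34 M \<longleftrightarrow> prob_space M \<and> sets M = sets borel \<and>
     (\<forall>B\<in>sets borel. measure M B = (measure M (tau_plus -` B) + measure M (tau_minus -` B)) / 2)"

text \<open>Well-defined by the theorem \<open>ex1_self_similar_34\<close> below.\<close>
definition nu34 :: "real measure" where
  "nu34 = (THE M. self_similar_34 M)"

definition expo :: "real \<Rightarrow> real \<Rightarrow> complex" where
  "expo l x = exp (2 * of_real pi * \<i> * of_real l * of_real x)"

definition mutually_orthogonal :: "real measure \<Rightarrow> real set \<Rightarrow> bool" where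
  "mutually_orthogonal M L \<longleftrightarrow>
     (\<forall>l\<in>L. \<forall>l'\<in>L. l \<noteq> l' \<longrightarrow> (LINT x|M. expo l x * cnj (expo l' x)) = 0)"

subsection \<open>Existence and uniqueness of the measure\<close>

definition coin :: "bool measure" where
  "coin = measure_pmf (pmf_of_set UNIV)"

definition coin_sign :: "bool \<Rightarrow> real" where
  "coin_sign b = (if b then 1 else -1)"

lemma prob_space_coin: "prob_space coin"
  unfolding coin_def by (rule prob_space_measure_pmf)

lemma sets_coin [measurable_cong, simp]: "sets coin = sets (count_space UNIV)"
  by (simp add: coin_def)

lemma space_coin [simp]: "space coin = UNIV"
  by (simp add: coin_def)

lemma nn_integral_coin: "(\<integral>\<^sup>+b. f b \<partial>coin) = ennreal (1/2) * f True + ennreal (1/2) * f False"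
proof -
  have "(\<integral>\<^sup>+b. f b \<partial>coin) = (\<Sum>b\<in>UNIV. f b * ennreal (pmf (pmf_of_set UNIV) b))"
    unfolding coin_def by (subst nn_integral_measure_pmf_finite) (auto simp: UNIV_bool)
  then show ?thesis
    by (simp add: UNIV_bool mult.commute add.commute)
qed

lemma ennreal_average:
  assumes "0 \<le> a" "0 \<le> b"
  shows "ennreal (1/2) * ennreal a + ennreal (1/2) * ennreal b = ennreal ((a + b) / 2)"
proof -
  have "ennreal (1/2) * ennreal a + ennreal (1/2) * ennreal b
      = ennreal (1/2 * a) + ennreal (1/2 * b)"
    using assms by (simp only: ennreal_mult)
  also have "\<dots> = ennreal (1/2 * a + 1/2 * b)"
    using assms by (intro ennreal_plus[symmetric]) auto
  finally show ?thesis
    by (simp add: add_divide_distrib)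
qed

lemma integral_coin:
  fixes f :: "bool \<Rightarrow> complex"
  shows "(LINT b|coin. f b) = (f True + f False) / 2"
proof -
  have "(LINT b|coin. f b) = (\<Sum>b\<in>UNIV. pmf (pmf_of_set UNIV) b *\<^sub>R f b)"
    unfolding coin_def by (rule integral_measure_pmf) auto
  then show ?thesis
    by (simp add: UNIV_bool scaleR_conv_of_real field_simps)
qed

lemma tau_measurable [measurable]:
  "tau_plus \<in> borel_measurable borel" "tau_minus \<in> borel_measurable borel"
  unfolding tau_plus_def[abs_def] tau_minus_def[abs_def] by measurable

lemma self_similar_34_eq_distr:
  assumes "self_similar_34 M"
  shows "M = distr (coin \<Otimes>\<^sub>M M) borel (\<lambda>(b, x). 3 / 4 * x + coin_sign b)"
proof (rule measure_eqI)
  have s [measurable_cong, simp]: "sets M = sets borel" and p: "prob_space M"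
    and eq: "\<And>B. B \<in> sets borel \<Longrightarrow>
      measure M B = (measure M (tau_plus -` B) + measure M (tau_minus -` B)) / 2"
    using assms by (auto simp: self_similar_34_def)
  interpret prob_space M by (rule p)
  have sp: "space M = UNIV"
    using sets_eq_imp_space_eq[OF s] by simp
  show "sets M = sets (distr (coin \<Otimes>\<^sub>M M) borel (\<lambda>(b, x). 3 / 4 * x + coin_sign b))"
    by simp
  fix B assume "B \<in> sets M"
  then have B [measurable]: "B \<in> sets borel" by simp
  have m [measurable]: "(\<lambda>(b, x). 3 / 4 * x + coin_sign b) \<in> coin \<Otimes>\<^sub>M M \<rightarrow>\<^sub>M borel"
    by measurable
  have "emeasure (distr (coin \<Otimes>\<^sub>M M) borel (\<lambda>(b, x). 3 / 4 * x + coin_sign b)) B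
      = emeasure (coin \<Otimes>\<^sub>M M)
          ((\<lambda>(b, x). 3 / 4 * x + coin_sign b) -` B \<inter> space (coin \<Otimes>\<^sub>M M))"
    by (rule emeasure_distr) auto
  also have "\<dots> = (\<integral>\<^sup>+b. emeasure M (Pair b -`
      ((\<lambda>(b, x). 3 / 4 * x + coin_sign b) -` B \<inter> space (coin \<Otimes>\<^sub>M M))) \<partial>coin)"
    by (rule emeasure_pair_measure_alt) measurable
  also have "\<dots> = ennreal (1/2) * emeasure M (tau_plus -` B)
      + ennreal (1/2) * emeasure M (tau_minus -` B)"
    unfolding nn_integral_coin
    by (simp add: space_pair_measure sp vimage_def coin_sign_def tau_plus_def tau_minus_def)
  also have "\<dots> = ennreal ((measure M (tau_plus -` B) + measure M (tau_minus -` B)) / 2)"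
    by (simp only: emeasure_eq_measure ennreal_average measure_nonneg)
  also have "\<dots> = emeasure M B"
    by (simp add: emeasure_eq_measure eq[OF B])
  finally show "emeasure M B
      = emeasure (distr (coin \<Otimes>\<^sub>M M) borel (\<lambda>(b, x). 3 / 4 * x + coin_sign b)) B" ..
qed

lemma char_self_similar_34:
  assumes "self_similar_34 M"
  shows "char M t = of_real (cos t) * char M (3 / 4 * t)"
proof -
  have s [measurable_cong, simp]: "sets M = sets borel" and p: "prob_space M"
    using assms by (auto simp: self_similar_34_def)
  interpret M: prob_space M by (rule p)
  interpret C: prob_space coin by (rule prob_space_coin)
  interpret P: pair_prob_space coin M ..
  have int: "integrable (coin \<Otimes>\<^sub>M M) (\<lambda>(b, x). iexp (t * (3 / 4 * x + coin_sign b)))"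
    by (rule P.P.integrable_const_bound[where B = 1]) (auto simp: split_beta)
  have "char M t = char (distr (coin \<Otimes>\<^sub>M M) borel (\<lambda>(b, x). 3 / 4 * x + coin_sign b)) t"
    using self_similar_34_eq_distr[OF assms] by simp
  also have "\<dots> = (LINT z|(coin \<Otimes>\<^sub>M M). (\<lambda>(b, x). iexp (t * (3 / 4 * x + coin_sign b))) z)"
    unfolding char_def by (subst integral_distr) (auto simp: case_prod_beta')
  also have "\<dots> = (LINT b|coin. LINT x|M. iexp (t * (3 / 4 * x + coin_sign b)))"
    using P.integral_fst'[OF int] by simp
  also have "\<dots> = (LINT b|coin. iexp (t * coin_sign b) * char M (3 / 4 * t))"
  proof (rule Bochner_Integration.integral_cong[OF refl])
    fix b
    have "(\<lambda>x. iexp (t * (3 / 4 * x + coin_sign b)))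
        = (\<lambda>x. iexp (t * coin_sign b) * iexp (3 / 4 * t * x))"
      by (simp add: exp_add[symmetric] algebra_simps)
    then show "(LINT x|M. iexp (t * (3 / 4 * x + coin_sign b)))
        = iexp (t * coin_sign b) * char M (3 / 4 * t)"
      unfolding char_def by simp
  qed
  also have "\<dots> = (iexp t + iexp (- t)) / 2 * char M (3 / 4 * t)"
    unfolding integral_coin by (simp add: coin_sign_def algebra_simps add_divide_distrib)
  also have "(iexp t + iexp (- t)) / 2 = of_real (cos t)"
    by (simp add: cos_exp_eq cos_of_real[symmetric])
  finally show ?thesis .
qed

lemma char_self_similar_34_tendsto:
  assumes "self_similar_34 M"
  shows "(\<lambda>n. of_real (\<Prod>k<n. cos ((3 / 4) ^ k * t))) \<longlonglongrightarrow> char M t"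
proof -
  have s: "sets M = sets borel" and p: "prob_space M"
    using assms by (auto simp: self_similar_34_def)
  interpret real_distribution M
    using p s by (auto simp: real_distribution_def real_distribution_axioms_def)
  define P where "P n = (complex_of_real (\<Prod>k<n. cos ((3 / 4) ^ k * t)))" for n
  have eq: "char M t = P n * char M ((3 / 4) ^ n * t)" for n
  proof (induction n)
    case (Suc n)
    then show ?case
      using char_self_similar_34[OF assms, of "(3 / 4) ^ n * t"] by (simp add: P_def mult_ac)
  qed (simp add: P_def)
  have "(\<lambda>n. (3 / 4 :: real) ^ n * t) \<longlonglongrightarrow> 0 * t"
    by (intro tendsto_mult LIMSEQ_realpow_zero tendsto_const) auto
  then have lim: "(\<lambda>n. char M ((3 / 4) ^ n * t)) \<longlonglongrightarrow> 1"
    using isCont_tendsto_compose[OF isCont_char[of 0]] by (simp add: char_zero)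
  then have "(\<lambda>n. char M t / char M ((3 / 4) ^ n * t)) \<longlonglongrightarrow> char M t / 1"
    by (intro tendsto_divide tendsto_const) auto
  moreover have "\<forall>\<^sub>F n in sequentially. char M ((3 / 4) ^ n * t) \<noteq> 0"
    using lim by (rule tendsto_imp_eventually_ne) simp
  then have "\<forall>\<^sub>F n in sequentially. char M t / char M ((3 / 4) ^ n * t) = P n"
    by eventually_elim (metis eq nonzero_mult_div_cancel_right)
  ultimately show ?thesis
    unfolding P_def by (simp add: filterlim_cong)
qed

lemma self_similar_34_unique:
  assumes "self_similar_34 M" "self_similar_34 N"
  shows "M = N"
proof (rule Levy_uniqueness)
  show "real_distribution M" "real_distribution N"
    using assms by (auto simp: self_similar_34_def real_distribution_def real_distribution_axioms_def)
  show "char M = char N"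
    using LIMSEQ_unique[OF char_self_similar_34_tendsto char_self_similar_34_tendsto] assms
    by blast
qed

definition random_sum :: "bool stream \<Rightarrow> real" where
  "random_sum \<omega> = (\<Sum>k. (3 / 4) ^ k * coin_sign (\<omega> !! k))"

lemma summable_random_sum: "summable (\<lambda>k. (3 / 4) ^ k * coin_sign (\<omega> !! k))"
proof (rule summable_comparison_test)
  show "\<exists>N. \<forall>n\<ge>N. norm ((3 / 4) ^ n * coin_sign (\<omega> !! n)) \<le> (3 / 4 :: real) ^ n"
    by (auto simp: coin_sign_def)
qed (simp add: summable_geometric)

lemma random_sum_Stream: "random_sum (b ## \<omega>) = 3 / 4 * random_sum \<omega> + coin_sign b"
  unfolding random_sum_def
  using suminf_split_head[OF summable_random_sum[of "b ## \<omega>"]]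
    suminf_mult[OF summable_random_sum[of \<omega>], of "3 / 4"]
  by (simp add: mult_ac)

lemma random_sum_measurable [measurable]: "random_sum \<in> borel_measurable (stream_space coin)"
proof -
  have [measurable]: "coin_sign \<in> borel_measurable coin"
    by (simp add: measurable_def coin_def)
  show ?thesis
    unfolding random_sum_def[abs_def] by measurable
qed

lemma self_similar_34_random_sum:
  "self_similar_34 (distr (stream_space coin) borel random_sum)"
proof -
  interpret C: prob_space coin by (rule prob_space_coin)
  interpret S: prob_space "stream_space coin" by (rule C.prob_space_stream_space)
  interpret D: prob_space "distr (stream_space coin) borel random_sum"
    by (rule S.prob_space_distr) measurable
  let ?D = "distr (stream_space coin) borel random_sum"
  have sp: "space (stream_space coin) = UNIV"
    by (simp add: space_stream_space)
  show ?thesis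
    unfolding self_similar_34_def
  proof (intro conjI ballI)
    fix B :: "real set" assume B [measurable]: "B \<in> sets borel"
    have tm: "tau_plus -` B \<in> sets borel" "tau_minus -` B \<in> sets borel"
      using measurable_sets[OF tau_measurable(1) B] measurable_sets[OF tau_measurable(2) B]
      by simp_all
    have "emeasure ?D B = emeasure (stream_space coin) (random_sum -` B)"
      by (subst emeasure_distr) (auto simp: sp)
    also have "\<dots> = (\<integral>\<^sup>+b. emeasure (stream_space coin)
        {\<omega> \<in> space (stream_space coin). b ## \<omega> \<in> random_sum -` B} \<partial>coin)"
      using measurable_sets[OF random_sum_measurable B]
      by (intro C.emeasure_stream_space) (simp add: sp)
    also have "\<dots> = ennreal (1/2) * emeasure ?D (tau_plus -` B)
        + ennreal (1/2) * emeasure ?D (tau_minus -` B)"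
      unfolding nn_integral_coin
      using tm by (simp add: emeasure_distr sp random_sum_Stream vimage_def coin_sign_def
          tau_plus_def tau_minus_def)
    also have "\<dots> = ennreal ((measure ?D (tau_plus -` B) + measure ?D (tau_minus -` B)) / 2)"
      by (simp only: D.emeasure_eq_measure ennreal_average measure_nonneg)
    finally show "measure ?D B = (measure ?D (tau_plus -` B) + measure ?D (tau_minus -` B)) / 2"
      by (simp add: D.emeasure_eq_measure)
  qed (auto intro: D.prob_space_axioms)
qed

theorem ex1_self_similar_34: "\<exists>!M. self_similar_34 M"
  using self_similar_34_random_sum self_similar_34_unique by blast

lemma self_similar_34_nu34: "self_similar_34 nu34"
  unfolding nu34_def by (rule theI'[OF ex1_self_similar_34])

end

theory Submission
  imports Defs
begin

text \<open>
  The inner product of \<open>e\<^sub>l\<close> and \<open>e\<^sub>l\<^sub>'\<close> is the characteristic function of \<open>\<nu>\<^bsub>3/4\<^esub>\<close> at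
  \<open>2\<pi>(l - l')\<close>. By self-similarity, this characteristic function \<open>\<phi>\<close> satisfies
  \<open>\<phi>(t) = cos t \<cdot> \<phi>(3t/4)\<close>, so it vanishes at \<open>(4/3)\<^sup>k \<cdot> q\<pi>/2\<close> for every odd integer \<open>q\<close>
  and every \<open>k\<close> (lemma \<open>char_nu34_eq_0\<close>). An odd \<open>q\<close> divisible by \<open>3\<^sup>k\<close> cancels the
  denominator, and therefore \<open>e\<^sub>l\<close> and \<open>e\<^sub>l\<^sub>'\<close> are orthogonal as soon as \<open>l - l'\<close> is an
  integer of the form \<open>4\<^sup>i p\<close> with \<open>p\<close> odd (lemma \<open>expo_orthogonal_nu34\<close>). For a fixed odd
  \<open>p\<close>, all differences of distinct elements of \<open>{p \<cdot> 4\<^sup>n | n \<ge> 0}\<close> have this form, since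
  \<open>4\<^sup>d - 1\<close> is odd for \<open>d > 0\<close>. Distinct odd numbers \<open>p\<close> yield distinct sets.
\<close>

lemma char_nu34_eq_0:
  assumes "odd q"
  shows "char nu34 ((4 / 3) ^ k * (of_int q * (pi / 2))) = 0"
proof (induction k)
  case 0
  have "cos (of_int q * (pi / 2)) = 0"
    using assms by (auto simp only: cos_zero_iff_int)
  then show ?case
    by (subst char_self_similar_34[OF self_similar_34_nu34]) simp
next
  case (Suc k)
  have "3 / 4 * ((4 / 3) ^ Suc k * (of_int q * (pi / 2))) = (4 / 3) ^ k * (of_int q * (pi / 2))"
    by simp
  then show ?case
    using char_self_similar_34[OF self_similar_34_nu34] Suc by (metis mult_zero_right)
qed

lemma integral_expo_cnj_expo: "(LINT x|M. expo l x * cnj (expo l' x)) = char M (2 * pi * (l - l'))"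
  unfolding char_def expo_def
  by (simp add: exp_cnj exp_add[symmetric] algebra_simps)

lemma expo_orthogonal_nu34:
  assumes "odd p" and "l - l' = 4 ^ i * of_int p"
  shows "(LINT x|nu34. expo l x * cnj (expo l' x)) = 0"
proof -
  have "2 * pi * (l - l') = (4 / 3) ^ Suc i * (of_int (3 ^ Suc i * p) * (pi / 2))"
    by (simp add: assms(2) power_divide)
  moreover have "odd (3 ^ Suc i * p)"
    using assms(1) by simp
  ultimately show ?thesis
    unfolding integral_expo_cnj_expo using char_nu34_eq_0 by metis
qed

text \<open>The frequencies \<open>p, 4p, 16p, \<dots>\<close>.\<close>

definition geometric_set :: "nat \<Rightarrow> real set" where
  "geometric_set p = range (\<lambda>n. real (p * 4 ^ n))"

lemma infinite_geometric_set:
  assumes "p > 0"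
  shows "infinite (geometric_set p)"
  unfolding geometric_set_def using assms by (intro range_inj_infinite) (simp add: inj_def)

lemma diff_mult_power_4:
  assumes "m < n"
  shows "real (p * 4 ^ n) - real (p * 4 ^ m) = 4 ^ m * of_int (int p * (4 ^ (n - m) - 1))"
proof -
  have "(4 :: real) ^ n = 4 ^ m * 4 ^ (n - m)"
    using assms by (simp flip: power_add)
  then show ?thesis
    by (simp add: algebra_simps)
qed

lemma mutually_orthogonal_geometric_set:
  assumes "odd p"
  shows "mutually_orthogonal nu34 (geometric_set p)"
  unfolding mutually_orthogonal_def
proof (intro ballI impI)
  fix l l' assume "l \<in> geometric_set p" "l' \<in> geometric_set p" and "l \<noteq> l'"
  then obtain n m where l: "l = real (p * 4 ^ n)" and l': "l' = real (p * 4 ^ m)" and "n \<noteq> m"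
    by (auto simp: geometric_set_def)
  have odd: "odd (int p * (4 ^ d - 1))" "odd (- (int p * (4 ^ d - 1)))" if "d > 0" for d
    using assms that by simp_all
  from \<open>n \<noteq> m\<close> consider "m < n" | "n < m" by linarith
  then show "(LINT x|nu34. expo l x * cnj (expo l' x)) = 0"
  proof cases
    case 1
    then show ?thesis
      using diff_mult_power_4[OF 1, of p] odd(1)[of "n - m"]
      by (intro expo_orthogonal_nu34) (auto simp only: l l' zero_less_diff)
  next
    case 2
    have "l - l' = 4 ^ n * of_int (- (int p * (4 ^ (m - n) - 1)))"
      using diff_mult_power_4[OF 2, of p] by (simp add: l l')
    with 2 show ?thesis
      using odd(2)[of "m - n"] by (intro expo_orthogonal_nu34) (auto simp only: zero_less_diff)
  qed
qed

lemma inj_on_geometric_set: "inj_on geometric_set {p. odd p}"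
proof (rule inj_onI)
  fix p q assume "p \<in> {p. odd p}" "q \<in> {p. odd p}" and eq: "geometric_set p = geometric_set q"
  have "real p \<in> geometric_set p"
    unfolding geometric_set_def by (rule range_eqI[of _ _ 0]) simp
  then obtain n where "real p = real (q * 4 ^ n)"
    using eq by (auto simp: geometric_set_def)
  then have "p = q * 4 ^ n"
    by (simp only: of_nat_eq_iff)
  \<comment> \<open>As \<open>p\<close> is odd, the exponent is zero.\<close>
  with \<open>p \<in> {p. odd p}\<close> show "p = q"
    by (cases n) auto
qed

theorem theorem3p3:
  shows "infinite {L :: real set. infinite L \<and> mutually_orthogonal nu34 L}"
proof (rule infinite_super)
  show "geometric_set ` {p. odd p} \<subseteq> {L. infinite L \<and> mutually_orthogonal nu34 L}"
    using infinite_geometric_set mutually_orthogonal_geometric_set odd_pos by auto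
  have "range (\<lambda>n::nat. 2 * n + 1) \<subseteq> {p. odd p}"
    by auto
  moreover have "infinite (range (\<lambda>n::nat. 2 * n + 1))"
    by (intro range_inj_infinite) (simp add: inj_def)
  ultimately have "infinite {p::nat. odd p}"
    by (rule infinite_super)
  then show "infinite (geometric_set ` {p. odd p})"
    using inj_on_geometric_set by (simp add: finite_image_iff)
qed

end
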